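(* Let $1\le p<\infty$. Let $\sigma_\hbar:\hbar\mathbb{Z}^n\times\mathbb{T}^n\to\mathbb{C}$ be a measurable function (with $\sigma_\hbar(k,\cdot)\in L^1(\mathbb{T}^n)$ for each $k$) such that $$|(\mathcal{F}_{\mathbb{T}^n}\sigma_\hbar)(k,m)|\le C|\lambda(m)|\qquad\text{for all }k,m\in\hbar\mathbb{Z}^n,$$ where $C>0$ is a constant, $\lambda$ is some function in $\ell^1(\hbar\mathbb{Z}^n)$, and $\mathcal{F}_{\mathbb{T}^n}\sigma_\hbar$ is the Fourier transform of $\sigma_\hbar$ in the second variable. Then $\mathrm{Op}_{\hbar\mathbb{Z}^n}(\sigma_\hbar):\ell^p(\hbar\mathbb{Z}^n)\to\ell^p(\hbar\mathbb{Z}^n)$ is a bounded linear operator and $$\|\mathrm{Op}_{\hbar\mathbb{Z}^n}(\sigma_\hbar)\|_{\mathscr{L}(\ell^p(\hbar\mathbb{Z}^n))}\le C\|\lambda\|_{\ell^1(\hbar\mathbb{Z}^n)}.$$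
   Context: Fix $n\ge1$ and $\hbar\in(0,1]$. $\hbar\mathbb{Z}^n=\{\hbar\bar k:\bar k\in\mathbb{Z}^n\}\subset\mathbb{R}^n$ with counting measure, $\mathbb{T}^n=\mathbb{R}^n/\mathbb{Z}^n$ with normalized Haar measure, $k\cdot\theta=\sum_jk_j\theta_j$. Semi-classical Fourier transform: $\widehat f(\theta)=\sum_{k\in\hbar\mathbb{Z}^n}e^{-2\pi\frac{i}{\hbar}k\cdot\theta}f(k)$. Quantization: $\mathrm{Op}_{\hbar\mathbb{Z}^n}(\sigma_\hbar)f(k)=\int_{\mathbb{T}^n}e^{2\pi\frac{i}{\hbar}k\cdot\theta}\sigma_\hbar(k,\theta)\widehat f(\theta)\,d\theta$ for $f\in\ell^1(\hbar\mathbb{Z}^n)$, extended to $\ell^p$ by density. The Fourier transform in the second variable is $(\mathcal{F}_{\mathbb{T}^n}\sigma_\hbar)(k,m)=\int_{\mathbb{T}^n}e^{-2\pi\frac{i}{\hbar}m\cdot\theta}\sigma_\hbar(k,\theta)\,d\theta$, $m\in\hbar\mathbb{Z}^n$. *)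

theory Defs
  imports "HOL-Analysis.Analysis"
begin

text \<open>
  Complex functions on the lattice \<open>\<hbar>\<int>\<^sup>n\<close> are represented by their extension by zero to
  \<^typ>\<open>real ^ 'n\<close>, and functions on \<open>\<real>\<^sup>n / \<int>\<^sup>n\<close> by \<open>\<int>\<^sup>n\<close>-periodic functions on \<^typ>\<open>real ^ 'n\<close>.
\<close>

definition int_vectors :: "(real ^ 'n) set" where
  "int_vectors = {z. \<forall>i. z $ i \<in> \<int>}"

definition hbar_lattice :: "real \<Rightarrow> (real ^ 'n) set" where
  "hbar_lattice h = (\<lambda>z. h *\<^sub>R z) ` int_vectors"

definition periodic :: "(real ^ 'n \<Rightarrow> complex) \<Rightarrow> bool" where
  "periodic u \<longleftrightarrow> (\<forall>\<theta>. \<forall>z \<in> int_vectors. u (\<theta> + z) = u \<theta>)"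

text \<open>
  Normalized Haar measure on the torus, transported to the fundamental domain \<open>[0,1)\<^sup>n\<close>.
\<close>

definition torus :: "(real ^ 'n) measure" where
  "torus = lebesgue_on {\<theta>. \<forall>i. \<theta> $ i \<in> {0..<1}}"


definition lp_space :: "real \<Rightarrow> real \<Rightarrow> (real ^ 'n \<Rightarrow> complex) set" where
  "lp_space h p =
     {f. (\<forall>k. k \<notin> hbar_lattice h \<longrightarrow> f k = 0) \<and> (\<lambda>k. norm (f k) powr p) summable_on hbar_lattice h}"

definition lp_norm :: "real \<Rightarrow> real \<Rightarrow> (real ^ 'n \<Rightarrow> complex) \<Rightarrow> real" where
  "lp_norm h p f = (\<Sum>\<^sub>\<infinity>k\<in>hbar_lattice h. norm (f k) powr p) powr (1 / p)"

definition lp_converges ::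
    "real \<Rightarrow> real \<Rightarrow> (nat \<Rightarrow> real ^ 'n \<Rightarrow> complex) \<Rightarrow> (real ^ 'n \<Rightarrow> complex) \<Rightarrow> bool" where
  "lp_converges h p F g \<longleftrightarrow>
     (\<forall>j. F j \<in> lp_space h p) \<and> g \<in> lp_space h p \<and>
     (\<lambda>j. lp_norm h p (\<lambda>k. F j k - g k)) \<longlonglongrightarrow> 0"

definition lp_bounded_linear ::
    "real \<Rightarrow> real \<Rightarrow> ((real ^ 'n \<Rightarrow> complex) \<Rightarrow> (real ^ 'n \<Rightarrow> complex)) \<Rightarrow> bool" where
  "lp_bounded_linear h p T \<longleftrightarrow>
     (\<forall>f \<in> lp_space h p. T f \<in> lp_space h p) \<and>
     (\<forall>f \<in> lp_space h p. \<forall>g \<in> lp_space h p. T (\<lambda>k. f k + g k) = (\<lambda>k. T f k + T g k)) \<and>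
     (\<forall>c. \<forall>f \<in> lp_space h p. T (\<lambda>k. c * f k) = (\<lambda>k. c * T f k)) \<and>
     (\<exists>B. \<forall>f \<in> lp_space h p. lp_norm h p (T f) \<le> B * lp_norm h p f)"

text \<open>As for \<^const>\<open>onorm\<close>, the zero function contributes \<open>0 / 0 = 0\<close> to the supremum.\<close>

definition lp_onorm ::
    "real \<Rightarrow> real \<Rightarrow> ((real ^ 'n \<Rightarrow> complex) \<Rightarrow> (real ^ 'n \<Rightarrow> complex)) \<Rightarrow> real" where
  "lp_onorm h p T = (SUP f \<in> lp_space h p. lp_norm h p (T f) / lp_norm h p f)"


definition lattice_fourier ::
    "real \<Rightarrow> (real ^ 'n \<Rightarrow> complex) \<Rightarrow> real ^ 'n \<Rightarrow> complex" where
  "lattice_fourier h f \<theta> =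
     (\<Sum>\<^sub>\<infinity>k\<in>hbar_lattice h. exp (- 2 * pi * \<i> / complex_of_real h * complex_of_real (k \<bullet> \<theta>)) * f k)"

definition symbol_fourier ::
    "real \<Rightarrow> (real ^ 'n \<Rightarrow> real ^ 'n \<Rightarrow> complex) \<Rightarrow> real ^ 'n \<Rightarrow> real ^ 'n \<Rightarrow> complex" where
  "symbol_fourier h \<sigma> k m =
     (LINT \<theta>|torus. exp (- 2 * pi * \<i> / complex_of_real h * complex_of_real (m \<bullet> \<theta>)) * \<sigma> k \<theta>)"

definition Op_l1 ::
    "real \<Rightarrow> (real ^ 'n \<Rightarrow> real ^ 'n \<Rightarrow> complex) \<Rightarrow>
     (real ^ 'n \<Rightarrow> complex) \<Rightarrow> (real ^ 'n \<Rightarrow> complex)" where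
  "Op_l1 h \<sigma> f k =
     (if k \<in> hbar_lattice h then
        (LINT \<theta>|torus. exp (2 * pi * \<i> / complex_of_real h * complex_of_real (k \<bullet> \<theta>))
           * \<sigma> k \<theta> * lattice_fourier h f \<theta>)
      else 0)"

text \<open>
  Extension by density: the value at \<open>f \<in> \<ell>\<^sup>p\<close> is the common \<open>\<ell>\<^sup>p\<close>-limit of the images of all
  sequences in \<open>\<ell>\<^sup>1\<close> that converge to \<open>f\<close> in \<open>\<ell>\<^sup>p\<close>. For \<open>1 \<le> p < \<infinity>\<close> such sequences exist, so
  there is at most one such limit; if there is none, the value is unspecified.
\<close>

definition Op ::
    "real \<Rightarrow> real \<Rightarrow> (real ^ 'n \<Rightarrow> real ^ 'n \<Rightarrow> complex) \<Rightarrow>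
     (real ^ 'n \<Rightarrow> complex) \<Rightarrow> (real ^ 'n \<Rightarrow> complex)" where
  "Op h p \<sigma> f =
     (THE g. \<forall>F. (\<forall>j. F j \<in> lp_space h 1) \<and> lp_converges h p F f
                  \<longrightarrow> lp_converges h p (\<lambda>j. Op_l1 h \<sigma> (F j)) g)"

end

theory Submission
  imports Defs
begin

text \<open>
  Integrating the Fourier series of \<open>f \<in> \<ell>\<^sup>1\<close> term by term shows that \<open>Op(\<sigma>)\<close> acts as the matrix
  with entries \<open>(\<F>\<sigma>)(k, m - k)\<close>, which are dominated by \<open>C \<bar>\<lambda>(m - k)\<bar>\<close>. All rows and columns of
  this convolution matrix have \<open>\<ell>\<^sup>1\<close> norm at most \<open>C \<parallel>\<lambda>\<parallel>\<^sub>1\<close>, so the Schur test (Jensen's inequality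
  in each row, then an exchange of sums) bounds it on \<open>\<ell>\<^sup>p\<close>. The matrix is then a continuous
  extension of \<open>Op(\<sigma>)\<close> from the dense subspace \<open>\<ell>\<^sup>1\<close>, and it is the only one, as \<open>\<ell>\<^sup>p\<close> limits are
  pointwise limits.
\<close>

section \<open>Convexity of powers and the Schur test\<close>

text \<open>This is the tangent inequality at \<open>s\<close> for the convex function
  \<open>t powr p\<close>. For p > 1 it is Young's inequality with the conjugate exponents p and p /
  (p - 1); at p = 1 the second exponent degenerates.\<close>

lemma powr_tangent:
  fixes s t p :: real
  assumes "p \<ge> 1" "s \<ge> 0" "t \<ge> 0"
  shows "p * t * s powr (p - 1) \<le> t powr p + (p - 1) * s powr p"
proof (cases "p = 1")
  case True
  then show ?thesis using assms by simp
next
  case False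
  then have p: "p > 1" using assms by simp
  have "t * s powr (p - 1) \<le> t powr p / p + (s powr (p - 1)) powr (p / (p - 1)) / (p / (p - 1))"
    using p assms by (intro Youngs_inequality) (auto simp: field_simps)
  also have "(s powr (p - 1)) powr (p / (p - 1)) = s powr p"
    using p by (simp add: powr_powr)
  finally show ?thesis using p by (simp add: field_simps)
qed

text \<open>Jensen's inequality for weights of total mass at most \<open>A\<close> instead of 1,
  which accounts for the factor \<open>A powr (p - 1)\<close>. Dividing by \<open>A\<close> rather
  than by the mass itself also covers mass 0.\<close>

lemma jensen_infsum:
  fixes w u :: "'a \<Rightarrow> real"
  assumes p: "p \<ge> 1" and A: "A > 0"
    and w: "\<And>m. m \<in> J \<Longrightarrow> w m \<ge> 0" "w summable_on J" "infsum w J \<le> A"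
    and u: "\<And>m. m \<in> J \<Longrightarrow> u m \<ge> 0"
    and wu: "(\<lambda>m. w m * u m) summable_on J" "(\<lambda>m. w m * u m powr p) summable_on J"
  shows "(\<Sum>\<^sub>\<infinity>m\<in>J. w m * u m) powr p \<le> A powr (p - 1) * (\<Sum>\<^sub>\<infinity>m\<in>J. w m * u m powr p)"
proof -
  define S s where "S = (\<Sum>\<^sub>\<infinity>m\<in>J. w m * u m)" and "s = S / A"
  have S: "S \<ge> 0" unfolding S_def using w u by (intro infsum_nonneg) auto
  have s: "s \<ge> 0" and SA: "S = A * s" using S A by (auto simp: s_def)
  have sp: "s * s powr (p - 1) = s powr p" using s powr_mult_base[of s "p - 1"] by simp
  \<comment> \<open>Sum the tangent inequality at the mean value \<open>s\<close> with weights \<open>w\<close>.\<close>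
  have "p * s powr (p - 1) * S = (\<Sum>\<^sub>\<infinity>m\<in>J. p * s powr (p - 1) * (w m * u m))"
    unfolding S_def by (simp add: infsum_cmult_right')
  also have "\<dots> \<le> (\<Sum>\<^sub>\<infinity>m\<in>J. w m * u m powr p + (p - 1) * s powr p * w m)"
  proof (intro infsum_mono summable_on_add summable_on_cmult_right wu w(2))
    fix m assume m: "m \<in> J"
    show "p * s powr (p - 1) * (w m * u m) \<le> w m * u m powr p + (p - 1) * s powr p * w m"
      using mult_left_mono[OF powr_tangent[OF p s u[OF m]] w(1)[OF m]]
      by (simp add: algebra_simps)
  qed
  also have "\<dots> = (\<Sum>\<^sub>\<infinity>m\<in>J. w m * u m powr p) + (p - 1) * s powr p * infsum w J"
    using wu w(2) by (simp add: infsum_add summable_on_cmult_right infsum_cmult_right')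
  also have "\<dots> \<le> (\<Sum>\<^sub>\<infinity>m\<in>J. w m * u m powr p) + (p - 1) * s powr p * A"
    using p w(3) by (intro add_left_mono mult_left_mono) auto
  \<comment> \<open>The chain starts at \<open>p * (A * s powr p)\<close>; subtracting
    \<open>(p - 1) * s powr p * A\<close> leaves one copy of \<open>A * s powr p\<close>.\<close>
  finally have "A * s powr p \<le> (\<Sum>\<^sub>\<infinity>m\<in>J. w m * u m powr p)"
    by (simp add: SA algebra_simps flip: sp)
  moreover have "S powr p = A powr (p - 1) * (A * s powr p)"
    using A powr_mult_base[of A "p - 1"] by (simp add: SA powr_mult s mult_ac)
  ultimately show ?thesis
    unfolding S_def by (simp add: mult_left_mono)
qed

lemma has_sum_sum:
  fixes f :: "'a \<Rightarrow> 'b \<Rightarrow> 'c :: topological_comm_monoid_add"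
  assumes "finite F" "\<And>k. k \<in> F \<Longrightarrow> (f k has_sum s k) J"
  shows "((\<lambda>m. \<Sum>k\<in>F. f k m) has_sum (\<Sum>k\<in>F. s k)) J"
  using assms by (induction F rule: finite_induct) (auto intro: has_sum_add)

text \<open>Jensen contributes \<open>A powr (p - 1)\<close> in each row, the column sums one more
  \<open>A\<close>. Sums are exchanged over finitely many rows at a time, so the column hypothesis
  speaks of finite sums; the uniform bound \<open>fin\<close> then gives summability over
  \<open>I\<close>.\<close>

lemma schur_test:
  fixes a :: "'a \<Rightarrow> 'b \<Rightarrow> real" and u :: "'b \<Rightarrow> real"
  assumes p: "p \<ge> 1" and A: "A > 0"
    and a: "\<And>k m. k \<in> I \<Longrightarrow> m \<in> J \<Longrightarrow> a k m \<ge> 0"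
    and rows: "\<And>k. k \<in> I \<Longrightarrow> a k summable_on J" "\<And>k. k \<in> I \<Longrightarrow> infsum (a k) J \<le> A"
    and cols: "\<And>m F. m \<in> J \<Longrightarrow> finite F \<Longrightarrow> F \<subseteq> I \<Longrightarrow> (\<Sum>k\<in>F. a k m) \<le> A"
    and u: "\<And>m. m \<in> J \<Longrightarrow> u m \<ge> 0" "(\<lambda>m. u m powr p) summable_on J"
  shows "\<And>k. k \<in> I \<Longrightarrow> (\<lambda>m. a k m * u m) summable_on J"
    and "(\<lambda>k. (\<Sum>\<^sub>\<infinity>m\<in>J. a k m * u m) powr p) summable_on I"
    and "(\<Sum>\<^sub>\<infinity>k\<in>I. (\<Sum>\<^sub>\<infinity>m\<in>J. a k m * u m) powr p) \<le> A powr p * (\<Sum>\<^sub>\<infinity>m\<in>J. u m powr p)"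
proof -
  define U where "U = (\<Sum>\<^sub>\<infinity>m\<in>J. u m powr p)"
  \<comment> \<open>Each term is at most the whole series, so \<open>u\<close> is bounded, and
    comparison with a constant multiple of the row \<open>a k\<close> gives \<open>s1\<close> and
    \<open>s2\<close>.\<close>
  have U: "u m powr p \<le> U" if "m \<in> J" for m
    using finite_sum_le_infsum[OF u(2), of "{m}"] that by (simp add: U_def)
  have ub: "u m \<le> U powr (1 / p)" if "m \<in> J" for m
    using powr_mono2[OF _ _ U[OF that], of "1 / p"] p u(1)[OF that] by (simp add: powr_powr)
  have s1: "(\<lambda>m. a k m * u m) summable_on J" if "k \<in> I" for k
    using that ub a u(1)
    by (intro summable_on_comparison_test[OF summable_on_cmult_left[OF rows(1)[OF that], of "U powr (1 / p)"]])
       (auto intro!: mult_left_mono)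
  have s2: "(\<lambda>m. a k m * u m powr p) summable_on J" if "k \<in> I" for k
    using that U a
    by (intro summable_on_comparison_test[OF summable_on_cmult_left[OF rows(1)[OF that], of U]])
       (auto intro!: mult_left_mono)
  have fin: "(\<Sum>k\<in>F. (\<Sum>\<^sub>\<infinity>m\<in>J. a k m * u m) powr p) \<le> A powr p * U"
    if F: "finite F" "F \<subseteq> I" for F
  proof -
    have swap: "((\<lambda>m. \<Sum>k\<in>F. a k m * u m powr p) has_sum
        (\<Sum>k\<in>F. \<Sum>\<^sub>\<infinity>m\<in>J. a k m * u m powr p)) J"
      using F s2 by (intro has_sum_sum has_sum_infsum) auto
    have "(\<Sum>k\<in>F. (\<Sum>\<^sub>\<infinity>m\<in>J. a k m * u m) powr p)
        \<le> (\<Sum>k\<in>F. A powr (p - 1) * (\<Sum>\<^sub>\<infinity>m\<in>J. a k m * u m powr p))"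
      using F by (intro sum_mono jensen_infsum p A a rows u(1) s1 s2) auto
    also have "\<dots> = A powr (p - 1) * (\<Sum>k\<in>F. \<Sum>\<^sub>\<infinity>m\<in>J. a k m * u m powr p)"
      by (simp add: sum_distrib_left)
    also have "(\<Sum>k\<in>F. \<Sum>\<^sub>\<infinity>m\<in>J. a k m * u m powr p) = (\<Sum>\<^sub>\<infinity>m\<in>J. \<Sum>k\<in>F. a k m * u m powr p)"
      using infsumI[OF swap] by simp
    also have "\<dots> \<le> (\<Sum>\<^sub>\<infinity>m\<in>J. A * u m powr p)"
      using cols[OF _ F]
      by (intro infsum_mono has_sum_imp_summable[OF swap] summable_on_cmult_right u(2))
         (auto simp flip: sum_distrib_right intro!: mult_right_mono)
    also have "\<dots> = A * U" by (simp add: U_def infsum_cmult_right')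
    also have "A powr (p - 1) * (A * U) = A powr p * U"
      using A powr_mult_base[of A "p - 1"] by (simp add: mult_ac)
    finally show ?thesis using A by (simp add: mult_left_mono)
  qed
  show "(\<lambda>m. a k m * u m) summable_on J" if "k \<in> I" for k by (rule s1[OF that])
  show s3: "(\<lambda>k. (\<Sum>\<^sub>\<infinity>m\<in>J. a k m * u m) powr p) summable_on I"
    using fin by (intro nonneg_bdd_above_summable_on bdd_aboveI2[where M="A powr p * U"]) auto
  show "(\<Sum>\<^sub>\<infinity>k\<in>I. (\<Sum>\<^sub>\<infinity>m\<in>J. a k m * u m) powr p) \<le> A powr p * (\<Sum>\<^sub>\<infinity>m\<in>J. u m powr p)"
    using infsum_le_finite_sums[OF s3 fin] by (simp add: U_def)
qed

section \<open>Exhaustion of countable sets by finite subsets\<close>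

text \<open>Infinite sums are limits along the net of finite subsets, while dominated convergence
  and the approximations in \<open>Op\<close> use sequences. The sets \<open>X j\<close> pass from
  one to the other.\<close>

lemma countable_exhaustion:
  assumes "countable L"
  obtains X :: "nat \<Rightarrow> 'a set"
  where "\<And>j. finite (X j)" "\<And>j. X j \<subseteq> L" "filterlim X (finite_subsets_at_top L) sequentially"
proof
  \<comment> \<open>Intersecting with \<open>L\<close> covers empty \<open>L\<close>, where the
    values of \<open>from_nat_into\<close> are unspecified.\<close>
  define X where "X j = from_nat_into L ` {..<j} \<inter> L" for j
  show "finite (X j)" "X j \<subseteq> L" for j by (auto simp: X_def)
  show "filterlim X (finite_subsets_at_top L) sequentially"
    unfolding filterlim_finite_subsets_at_top
  proof safe
    fix Y assume Y: "finite Y" "Y \<subseteq> L"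
    obtain N where N: "\<And>y. y \<in> Y \<Longrightarrow> to_nat_on L y < N"
      using finite_nat_set_iff_bounded[of "to_nat_on L ` Y"] Y by auto
    show "\<forall>\<^sub>F j in sequentially. finite (X j) \<and> Y \<subseteq> X j \<and> X j \<subseteq> L"
      using eventually_ge_at_top[of N]
    proof eventually_elim
      case (elim j)
      have "y \<in> X j" if "y \<in> Y" for y
      proof -
        have "y = from_nat_into L (to_nat_on L y)" "to_nat_on L y < j" "y \<in> L"
          using that Y N[OF that] elim assms by auto
        then show ?thesis unfolding X_def by blast
      qed
      then show ?case by (auto simp: X_def)
    qed
  qed
qed

lemma has_sum_imp_tendsto:
  assumes "(g has_sum x) L" "filterlim X (finite_subsets_at_top L) F"
  shows "((\<lambda>j. sum g (X j)) \<longlongrightarrow> x) F"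
  using filterlim_compose[OF assms(1)[unfolded has_sum_def] assms(2)] .

section \<open>The lattice as a countable group\<close>

lemma countable_int_vectors: "countable (int_vectors :: (real ^ 'n) set)"
proof -
  have "countable (PiE (UNIV :: 'n set) (\<lambda>_. \<int> :: real set))"
    by (intro countable_PiE) (auto simp: Ints_def)
  then have "countable (vec_lambda ` PiE (UNIV :: 'n set) (\<lambda>_. \<int> :: real set))"
    by (rule countable_image)
  moreover have "z \<in> vec_lambda ` PiE (UNIV :: 'n set) (\<lambda>_. \<int> :: real set)"
    if "z \<in> int_vectors" for z :: "real ^ 'n"
    using that by (intro image_eqI[of _ _ "vec_nth z"]) (auto simp: int_vectors_def)
  ultimately show ?thesis by (meson countable_subset subsetI)
qed

lemma countable_hbar_lattice: "countable (hbar_lattice h)"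
  by (simp add: hbar_lattice_def countable_int_vectors)

lemma hbar_lattice_diff:
  assumes "x \<in> hbar_lattice h" "y \<in> hbar_lattice h"
  shows "x - y \<in> hbar_lattice h"
proof -
  obtain u v where "x = h *\<^sub>R u" "y = h *\<^sub>R v" "u \<in> int_vectors" "v \<in> int_vectors"
    using assms by (auto simp: hbar_lattice_def)
  then show ?thesis
    by (auto simp: hbar_lattice_def int_vectors_def scaleR_diff_right
        intro!: image_eqI[of _ _ "u - v"])
qed

lemma zero_in_hbar_lattice: "0 \<in> hbar_lattice h"
  by (auto simp: hbar_lattice_def int_vectors_def intro!: image_eqI[of _ _ 0])

lemma hbar_lattice_uminus: "x \<in> hbar_lattice h \<Longrightarrow> - x \<in> hbar_lattice h"
  using hbar_lattice_diff[OF zero_in_hbar_lattice] by fastforce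

lemma hbar_lattice_add:
  "x \<in> hbar_lattice h \<Longrightarrow> y \<in> hbar_lattice h \<Longrightarrow> x + y \<in> hbar_lattice h"
  using hbar_lattice_diff[OF _ hbar_lattice_uminus] by fastforce

text \<open>Translation invariance makes each row of a convolution matrix a rearrangement of one and
  the same family.\<close>

lemma bij_betw_hbar_lattice_shift:
  "k \<in> hbar_lattice h \<Longrightarrow> bij_betw (\<lambda>m. m - k) (hbar_lattice h) (hbar_lattice h)"
  by (rule bij_betwI[where g = "\<lambda>m. m + k"]) (auto intro: hbar_lattice_diff hbar_lattice_add)

section \<open>The spaces l^p: membership, pointwise limits, density\<close>

lemma lp_space_summable: "f \<in> lp_space h p \<Longrightarrow> (\<lambda>k. norm (f k) powr p) summable_on hbar_lattice h"
  and lp_space_outside: "f \<in> lp_space h p \<Longrightarrow> k \<notin> hbar_lattice h \<Longrightarrow> f k = 0"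
  by (auto simp: lp_space_def)

lemma lp_norm_nonneg: "lp_norm h p f \<ge> 0"
  by (simp add: lp_norm_def)

text \<open>A single term is at most the whole series, and off the lattice \<open>f\<close>
  vanishes. Hence l^p convergence implies pointwise convergence on the whole ambient space.\<close>

lemma norm_le_lp_norm:
  assumes f: "f \<in> lp_space h p" and p: "p \<ge> 1"
  shows "norm (f k) \<le> lp_norm h p f"
proof (cases "k \<in> hbar_lattice h")
  case True
  then have "norm (f k) powr p \<le> (\<Sum>\<^sub>\<infinity>k\<in>hbar_lattice h. norm (f k) powr p)"
    using finite_sum_le_infsum[OF lp_space_summable[OF f], of "{k}"] by simp
  from powr_mono2[OF _ _ this, of "1 / p"] show ?thesis
    using p by (simp add: lp_norm_def powr_powr)
next
  case False
  then show ?thesis using f by (simp add: lp_norm_nonneg lp_space_outside)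
qed

lemma zero_in_lp_space: "(\<lambda>k. 0) \<in> lp_space h p"
  by (simp add: lp_space_def)

lemma lp_space_cmult: "f \<in> lp_space h p \<Longrightarrow> (\<lambda>k. c * f k) \<in> lp_space h p"
  by (auto simp: lp_space_def norm_mult powr_mult intro: summable_on_cmult_right)

text \<open>The sum of two numbers is at most twice their maximum, and the p-th power of the maximum
  is at most the sum of the p-th powers.\<close>

lemma lp_space_add:
  assumes f: "f \<in> lp_space h p" and g: "g \<in> lp_space h p" and p: "p \<ge> 1"
  shows "(\<lambda>k. f k + g k) \<in> lp_space h p"
proof -
  have "norm (f k + g k) powr p \<le> 2 powr p * (norm (f k) powr p + norm (g k) powr p)" for k
  proof -
    have "norm (f k + g k) powr p \<le> (2 * max (norm (f k)) (norm (g k))) powr p"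
      using p norm_triangle_ineq[of "f k" "g k"] by (intro powr_mono2) auto
    also have "\<dots> \<le> 2 powr p * (norm (f k) powr p + norm (g k) powr p)"
      by (auto simp: powr_mult max_def)
    finally show ?thesis .
  qed
  then have "(\<lambda>k. norm (f k + g k) powr p) summable_on hbar_lattice h"
    by (intro summable_on_comparison_test[OF summable_on_cmult_right
          [OF summable_on_add[OF lp_space_summable[OF f] lp_space_summable[OF g]], of "2 powr p"]]) auto
  then show ?thesis using f g by (auto simp: lp_space_def)
qed

lemma lp_space_diff:
  assumes "f \<in> lp_space h p" "g \<in> lp_space h p" "p \<ge> 1"
  shows "(\<lambda>k. f k - g k) \<in> lp_space h p"
  using lp_space_add[OF assms(1) lp_space_cmult[OF assms(2), of "-1"] assms(3)] by simp

text \<open>A function in l^1 is bounded by its norm, so p - 1 of the p factors in each term can be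
  replaced by a constant.\<close>

lemma lp_space_1_subset:
  assumes f: "f \<in> lp_space h 1" and p: "p \<ge> 1"
  shows "f \<in> lp_space h p"
proof -
  have "norm (f k) powr p \<le> norm (f k) powr 1 * lp_norm h 1 f powr (p - 1)" for k
  proof -
    have "norm (f k) powr p = norm (f k) * norm (f k) powr (p - 1)"
      by (simp add: powr_mult_base)
    also have "\<dots> \<le> norm (f k) * lp_norm h 1 f powr (p - 1)"
      using p by (intro mult_left_mono powr_mono2 norm_le_lp_norm[OF f]) auto
    finally show ?thesis by simp
  qed
  then have "(\<lambda>k. norm (f k) powr p) summable_on hbar_lattice h"
    by (intro summable_on_comparison_test[OF summable_on_cmult_left[OF lp_space_summable[OF f]]]) auto
  then show ?thesis using f by (auto simp: lp_space_def)
qed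

lemma finite_support_in_lp_space:
  assumes "finite X" "X \<subseteq> hbar_lattice h"
  shows "(\<lambda>k. if k \<in> X then f k else 0) \<in> lp_space h p"
proof -
  have "(\<lambda>k. norm (if k \<in> X then f k else 0) powr p) summable_on hbar_lattice h \<longleftrightarrow>
        (\<lambda>k. norm (f k) powr p) summable_on X"
    using assms by (intro summable_on_cong_neutral) auto
  then show ?thesis using assms by (auto simp: lp_space_def)
qed

lemma lp_converges_unique:
  assumes "lp_converges h p F g" "lp_converges h p F g'" "p \<ge> 1"
  shows "g = g'"
proof
  fix k
  have lim: "(\<lambda>j. F j k) \<longlonglongrightarrow> G k" if "lp_converges h p F G" for G
  proof (rule LIM_zero_cancel, rule Lim_null_comparison)
    show "(\<lambda>j. lp_norm h p (\<lambda>k. F j k - G k)) \<longlonglongrightarrow> 0"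
      using that by (simp add: lp_converges_def)
    show "\<forall>\<^sub>F j in sequentially. norm (F j k - G k) \<le> lp_norm h p (\<lambda>k. F j k - G k)"
      using that assms(3)
      by (intro always_eventually allI norm_le_lp_norm[where f="\<lambda>k. F _ k - G k"] lp_space_diff)
         (auto simp: lp_converges_def)
  qed
  show "g k = g' k"
    using LIMSEQ_unique[OF lim[OF assms(1)] lim[OF assms(2)]] .
qed

text \<open>Truncations of \<open>f\<close> to an exhausting sequence of finite sets have finite
  support, and the p-th power of the error is the tail of a convergent series.\<close>

lemma lp_space_1_dense:
  assumes f: "f \<in> lp_space h p" and p: "p \<ge> 1"
  obtains F where "\<And>j. F j \<in> lp_space h 1" "lp_converges h p F f"
proof -
  obtain X :: "nat \<Rightarrow> (real ^ 'a) set" where X: "\<And>j. finite (X j)" "\<And>j. X j \<subseteq> hbar_lattice h"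
      "filterlim X (finite_subsets_at_top (hbar_lattice h)) sequentially"
    using countable_exhaustion[OF countable_hbar_lattice] by metis
  define F where "F j k = (if k \<in> X j then f k else 0)" for j k
  have F: "F j \<in> lp_space h q" for j q
    unfolding F_def by (rule finite_support_in_lp_space[OF X(1,2)])
  define S where "S = (\<Sum>\<^sub>\<infinity>k\<in>hbar_lattice h. norm (f k) powr p)"
  have "lp_norm h p (\<lambda>k. F j k - f k) = (S - (\<Sum>k\<in>X j. norm (f k) powr p)) powr (1 / p)" for j
  proof -
    have "(\<Sum>\<^sub>\<infinity>k\<in>hbar_lattice h. norm (F j k - f k) powr p)
        = (\<Sum>\<^sub>\<infinity>k\<in>hbar_lattice h - X j. norm (f k) powr p)"
      by (rule infsum_cong_neutral) (auto simp: F_def)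
    also have "\<dots> = S - (\<Sum>k\<in>X j. norm (f k) powr p)"
      using X(1,2)[of j] lp_space_summable[OF f] by (subst infsum_Diff) (auto simp: S_def)
    finally show ?thesis by (simp add: lp_norm_def)
  qed
  moreover have "(\<lambda>j. (S - (\<Sum>k\<in>X j. norm (f k) powr p)) powr (1 / p)) \<longlonglongrightarrow> 0"
  proof -
    have "(\<lambda>j. \<Sum>k\<in>X j. norm (f k) powr p) \<longlonglongrightarrow> S"
      unfolding S_def using lp_space_summable[OF f] X(3)
      by (intro has_sum_imp_tendsto[OF has_sum_infsum])
    then have "(\<lambda>j. S - (\<Sum>k\<in>X j. norm (f k) powr p)) \<longlonglongrightarrow> 0"
      using tendsto_diff[OF tendsto_const[of S]] by fastforce
    moreover have "S - (\<Sum>k\<in>X j. norm (f k) powr p) \<ge> 0" for j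
      using finite_sum_le_infsum[OF lp_space_summable[OF f] X(1,2)[of j]] by (simp add: S_def)
    ultimately show ?thesis
      using p by (intro tendsto_zero_powrI[where b="1 / p"]) (auto intro: always_eventually)
  qed
  ultimately have "lp_converges h p F f"
    using f F by (simp add: lp_converges_def)
  with F show thesis by (rule that)
qed

section \<open>Matrix form of the operator on l^1\<close>

text \<open>The formula does not mention p, so the same operator serves on l^1 and on l^p. Where the
  series diverges, \<open>infsum\<close> is 0; convergence is therefore established
  separately.\<close>

definition kernel_op ::
    "real \<Rightarrow> (real ^ 'n \<Rightarrow> real ^ 'n \<Rightarrow> complex) \<Rightarrow>
     (real ^ 'n \<Rightarrow> complex) \<Rightarrow> (real ^ 'n \<Rightarrow> complex)" where
  "kernel_op h \<sigma> f k =
     (if k \<in> hbar_lattice h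
      then \<Sum>\<^sub>\<infinity>m\<in>hbar_lattice h. symbol_fourier h \<sigma> k (m - k) * f m else 0)"

abbreviation character :: "real \<Rightarrow> real ^ 'n \<Rightarrow> real ^ 'n \<Rightarrow> complex" where
  "character h m \<theta> \<equiv> exp (- 2 * pi * \<i> / complex_of_real h * complex_of_real (m \<bullet> \<theta>))"

lemma norm_character: "norm (character h m \<theta>) = 1"
  and norm_character_pos:
    "norm (exp (2 * pi * \<i> / complex_of_real h * complex_of_real (m \<bullet> \<theta>))) = 1"
  by (simp_all add: norm_exp_eq_Re)

text \<open>This shift of frequency is the source of the index \<open>m - k\<close> in
  \<open>kernel_op\<close>.\<close>

lemma character_diff:
  "exp (2 * pi * \<i> / complex_of_real h * complex_of_real (k \<bullet> \<theta>)) * character h m \<theta>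
     = character h (m - k) \<theta>"
  by (simp add: inner_diff_left algebra_simps diff_divide_distrib flip: exp_add)

lemma borel_measurable_torus_continuous:
  fixes g :: "real ^ 'n \<Rightarrow> 'b :: metric_space"
  assumes "continuous_on UNIV g"
  shows "g \<in> borel_measurable torus"
  using assms unfolding torus_def
  by (intro measurable_restrict_space1 measurable_completion) (simp add: borel_measurable_continuous_onI)

lemma borel_measurable_character: "character h m \<in> borel_measurable torus"
  and borel_measurable_character_pos:
    "(\<lambda>\<theta>. exp (2 * pi * \<i> / complex_of_real h * complex_of_real (m \<bullet> \<theta>))) \<in> borel_measurable torus"
  by (intro borel_measurable_torus_continuous continuous_intros)+

text \<open>These are the two inputs of dominated convergence: pointwise convergence of the Fourier
  series and a bound on its partial sums uniform in \<open>\<theta>\<close> and \<open>X\<close>.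
  Both hold because characters have modulus 1.\<close>

lemma lattice_fourier_partial_sums:
  assumes f: "f \<in> lp_space h 1"
  shows "((\<lambda>m. character h m \<theta> * f m) has_sum lattice_fourier h f \<theta>) (hbar_lattice h)"
    and "finite X \<Longrightarrow> X \<subseteq> hbar_lattice h \<Longrightarrow> norm (\<Sum>m\<in>X. character h m \<theta> * f m) \<le> lp_norm h 1 f"
proof -
  have abs: "(\<lambda>m. norm (f m)) summable_on hbar_lattice h"
    using lp_space_summable[OF f] by simp
  have "(\<lambda>m. norm (character h m \<theta> * f m)) summable_on hbar_lattice h"
    using abs by (simp add: norm_mult norm_character)
  then show "((\<lambda>m. character h m \<theta> * f m) has_sum lattice_fourier h f \<theta>) (hbar_lattice h)"
    unfolding lattice_fourier_def by (rule has_sum_infsum[OF abs_summable_summable])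
  assume X: "finite X" "X \<subseteq> hbar_lattice h"
  have "norm (\<Sum>m\<in>X. character h m \<theta> * f m) \<le> (\<Sum>m\<in>X. norm (f m))"
    by (rule sum_norm_le) (simp add: norm_mult norm_character)
  also have "\<dots> \<le> lp_norm h 1 f"
    using finite_sum_le_infsum[OF abs X] by (simp add: lp_norm_def infsum_nonneg)
  finally show "norm (\<Sum>m\<in>X. character h m \<theta> * f m) \<le> lp_norm h 1 f" .
qed

text \<open>Dominated convergence, with majorant
  \<open>norm (\<sigma> k \<theta>) * lp_norm h 1 f\<close>, moves the integral inside the Fourier
  series of \<open>f\<close>; each integrated term is an entry of the matrix times a value of
  \<open>f\<close>.\<close>

lemma Op_l1_eq_kernel_op:
  assumes \<sigma>: "\<And>k. k \<in> hbar_lattice h \<Longrightarrow> integrable torus (\<sigma> k)"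
    and f: "f \<in> lp_space h 1"
    and K: "\<And>k. k \<in> hbar_lattice h \<Longrightarrow>
       (\<lambda>m. symbol_fourier h \<sigma> k (m - k) * f m) summable_on hbar_lattice h"
  shows "Op_l1 h \<sigma> f = kernel_op h \<sigma> f"
proof
  fix k
  show "Op_l1 h \<sigma> f k = kernel_op h \<sigma> f k"
  proof (cases "k \<in> hbar_lattice h")
    case k: True
    define e where "e \<theta> = exp (2 * pi * \<i> / complex_of_real h * complex_of_real (k \<bullet> \<theta>))" for \<theta>
    obtain X :: "nat \<Rightarrow> (real ^ 'a) set" where X: "\<And>j. finite (X j)" "\<And>j. X j \<subseteq> hbar_lattice h"
        "filterlim X (finite_subsets_at_top (hbar_lattice h)) sequentially"
      using countable_exhaustion[OF countable_hbar_lattice] by metis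
    have e [measurable]: "e \<in> borel_measurable torus"
      unfolding e_def by (rule borel_measurable_character_pos)
    have ne: "norm (e \<theta>) = 1" for \<theta> unfolding e_def by (rule norm_character_pos)
    have \<sigma>m [measurable]: "\<sigma> k \<in> borel_measurable torus" using \<sigma>[OF k] by simp
    note borel_measurable_character [measurable]
    define s where "s j \<theta> = e \<theta> * \<sigma> k \<theta> * (\<Sum>m\<in>X j. character h m \<theta> * f m)" for j \<theta>
    have lim: "(\<lambda>j. s j \<theta>) \<longlonglongrightarrow> e \<theta> * \<sigma> k \<theta> * lattice_fourier h f \<theta>" for \<theta>
      unfolding s_def
      by (intro tendsto_intros has_sum_imp_tendsto[OF _ X(3)] lattice_fourier_partial_sums(1) f)
    have sm: "s j \<in> borel_measurable torus" for j
      unfolding s_def by measurable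
    have "(\<lambda>j. LINT \<theta>|torus. s j \<theta>) \<longlonglongrightarrow> (LINT \<theta>|torus. e \<theta> * \<sigma> k \<theta> * lattice_fourier h f \<theta>)"
    proof (rule integral_dominated_convergence[where w = "\<lambda>\<theta>. norm (\<sigma> k \<theta>) * lp_norm h 1 f"])
      show "(\<lambda>\<theta>. e \<theta> * \<sigma> k \<theta> * lattice_fourier h f \<theta>) \<in> borel_measurable torus"
        by (rule borel_measurable_LIMSEQ_metric[OF sm lim])
      show "integrable torus (\<lambda>\<theta>. norm (\<sigma> k \<theta>) * lp_norm h 1 f)"
        using \<sigma>[OF k] by simp
      show "AE \<theta> in torus. norm (s j \<theta>) \<le> norm (\<sigma> k \<theta>) * lp_norm h 1 f" for j
        using lattice_fourier_partial_sums(2)[OF f X(1,2)]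
        by (intro AE_I2) (simp add: s_def norm_mult ne mult_left_mono)
    qed (use sm lim in auto)
    moreover have "(LINT \<theta>|torus. s j \<theta>) = (\<Sum>m\<in>X j. symbol_fourier h \<sigma> k (m - k) * f m)" for j
    proof -
      have "s j = (\<lambda>\<theta>. \<Sum>m\<in>X j. character h (m - k) \<theta> * \<sigma> k \<theta> * f m)"
        unfolding s_def e_def sum_distrib_left character_diff[symmetric] by (simp add: mult_ac)
      moreover have "integrable torus (\<lambda>\<theta>. character h m \<theta> * \<sigma> k \<theta>)" for m
        using borel_measurable_times[OF borel_measurable_character \<sigma>m]
        by (rule Bochner_Integration.integrable_bound[OF \<sigma>[OF k]])
           (intro AE_I2, simp only: norm_mult norm_character mult_1 order_refl)
      ultimately show ?thesis
        by (simp add: symbol_fourier_def)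
    qed
    \<comment> \<open>By \<open>K\<close> the same sequence also tends to the matrix series, and
      uniqueness of limits concludes.\<close>
    moreover have "(\<lambda>j. \<Sum>m\<in>X j. symbol_fourier h \<sigma> k (m - k) * f m) \<longlonglongrightarrow> kernel_op h \<sigma> f k"
      using k by (auto simp: kernel_op_def intro!: has_sum_imp_tendsto[OF _ X(3)] has_sum_infsum K)
    ultimately show ?thesis
      using k LIMSEQ_unique by (fastforce simp: Op_l1_def e_def)
  qed (simp add: Op_l1_def kernel_op_def)
qed

section \<open>Boundedness of the matrix on l^p\<close>

text \<open>The entries are dominated by the convolution matrix \<open>a (m - k)\<close>, to which
  the Schur test applies. \<open>A\<close> is any positive upper bound of the sum of
  \<open>a\<close>, as the sum itself may be 0.\<close>

lemma kernel_op_bounded: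
  assumes p: "1 \<le> p" and A: "A > 0"
    and a: "a summable_on hbar_lattice h" "infsum a (hbar_lattice h) \<le> A"
    and \<sigma>: "\<And>k m. k \<in> hbar_lattice h \<Longrightarrow> m \<in> hbar_lattice h \<Longrightarrow> norm (symbol_fourier h \<sigma> k m) \<le> a m"
    and f: "f \<in> lp_space h p"
  shows "\<And>k. k \<in> hbar_lattice h \<Longrightarrow>
       (\<lambda>m. symbol_fourier h \<sigma> k (m - k) * f m) summable_on hbar_lattice h"
    and "kernel_op h \<sigma> f \<in> lp_space h p"
    and "lp_norm h p (kernel_op h \<sigma> f) \<le> A * lp_norm h p f"
proof -
  let ?L = "hbar_lattice h"
  have a0: "a m \<ge> 0" if "m \<in> ?L" for m
    using \<sigma>[OF zero_in_hbar_lattice that] norm_ge_zero order_trans by blast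
  have rows: "(\<lambda>m. a (m - k)) summable_on ?L" "(\<Sum>\<^sub>\<infinity>m\<in>?L. a (m - k)) \<le> A" if "k \<in> ?L" for k
    using bij_betw_hbar_lattice_shift[OF that] a
    by (simp_all add: summable_on_reindex_bij_betw[where f = a] infsum_reindex_bij_betw[where f = a])
  \<comment> \<open>For fixed \<open>m\<close> the map from \<open>k\<close> to \<open>m - k\<close>
    is injective into the lattice, so a finite column sum is a partial sum of
    \<open>a\<close>.\<close>
  have cols: "(\<Sum>k\<in>F. a (m - k)) \<le> A" if "m \<in> ?L" "finite F" "F \<subseteq> ?L" for m F
  proof -
    have inj: "inj_on ((-) m) F" by (auto simp: inj_on_def)
    have "(\<Sum>k\<in>F. a (m - k)) = sum a ((-) m ` F)"
      by (simp add: sum.reindex[OF inj])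
    also have "\<dots> \<le> infsum a ?L"
      using that a0 by (intro finite_sum_le_infsum a(1)) (auto intro: hbar_lattice_diff)
    finally show ?thesis using a(2) by simp
  qed
  have a0': "a (m - k) \<ge> 0" if "k \<in> ?L" "m \<in> ?L" for k m
    using that by (intro a0 hbar_lattice_diff)
  have schur: "k \<in> ?L \<Longrightarrow> (\<lambda>m. a (m - k) * norm (f m)) summable_on ?L"
    "(\<lambda>k. (\<Sum>\<^sub>\<infinity>m\<in>?L. a (m - k) * norm (f m)) powr p) summable_on ?L"
    "(\<Sum>\<^sub>\<infinity>k\<in>?L. (\<Sum>\<^sub>\<infinity>m\<in>?L. a (m - k) * norm (f m)) powr p)
       \<le> A powr p * (\<Sum>\<^sub>\<infinity>m\<in>?L. norm (f m) powr p)" for k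
    by (rule schur_test[where a = "\<lambda>k m. a (m - k)", OF p A];
        (intro a0' rows cols norm_ge_zero lp_space_summable[OF f])?; assumption)+
  have bound: "norm (symbol_fourier h \<sigma> k (m - k) * f m) \<le> a (m - k) * norm (f m)"
    if "k \<in> ?L" "m \<in> ?L" for k m
    using that by (auto simp: norm_mult intro!: mult_right_mono \<sigma> hbar_lattice_diff)
  have abs: "(\<lambda>m. norm (symbol_fourier h \<sigma> k (m - k) * f m)) summable_on ?L" if "k \<in> ?L" for k
    using that bound by (intro Infinite_Sum.abs_summable_on_comparison_test'[OF schur(1)])
  show "(\<lambda>m. symbol_fourier h \<sigma> k (m - k) * f m) summable_on ?L" if "k \<in> ?L" for k
    using abs[OF that] by (rule abs_summable_summable)
  have pt: "norm (kernel_op h \<sigma> f k) powr p \<le> (\<Sum>\<^sub>\<infinity>m\<in>?L. a (m - k) * norm (f m)) powr p"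
    if k: "k \<in> ?L" for k
  proof (rule powr_mono2)
    have "norm (kernel_op h \<sigma> f k) \<le> (\<Sum>\<^sub>\<infinity>m\<in>?L. norm (symbol_fourier h \<sigma> k (m - k) * f m))"
      using norm_infsum_bound[OF abs[OF k]] k by (simp add: kernel_op_def)
    also have "\<dots> \<le> (\<Sum>\<^sub>\<infinity>m\<in>?L. a (m - k) * norm (f m))"
      using k by (intro infsum_mono abs schur(1) bound)
    finally show "norm (kernel_op h \<sigma> f k) \<le> (\<Sum>\<^sub>\<infinity>m\<in>?L. a (m - k) * norm (f m))" .
  qed (use p in auto)
  have summable: "(\<lambda>k. norm (kernel_op h \<sigma> f k) powr p) summable_on ?L"
    by (rule summable_on_comparison_test[OF schur(2) pt]) auto
  then show "kernel_op h \<sigma> f \<in> lp_space h p"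
    by (auto simp: lp_space_def kernel_op_def)
  have "(\<Sum>\<^sub>\<infinity>k\<in>?L. norm (kernel_op h \<sigma> f k) powr p) \<le> A powr p * (\<Sum>\<^sub>\<infinity>m\<in>?L. norm (f m) powr p)"
    using infsum_mono[OF summable schur(2) pt] schur(3) by linarith
  then have "lp_norm h p (kernel_op h \<sigma> f) \<le> (A powr p * (\<Sum>\<^sub>\<infinity>m\<in>?L. norm (f m) powr p)) powr (1 / p)"
    unfolding lp_norm_def using p by (intro powr_mono2) (auto intro: infsum_nonneg)
  also have "\<dots> = A * lp_norm h p f"
    using A p by (simp add: lp_norm_def powr_mult powr_powr infsum_nonneg)
  finally show "lp_norm h p (kernel_op h \<sigma> f) \<le> A * lp_norm h p f" .
qed

section \<open>Extension by density and the norm bound\<close>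

text \<open>The hypothesis \<open>lim\<close> makes \<open>g\<close> a candidate for the definite
  description. Density provides at least one approximating sequence, along which any other candidate
  has the same limit.\<close>

lemma Op_eqI:
  assumes p: "1 \<le> p" and f: "f \<in> lp_space h p"
    and lim: "\<And>F. (\<And>j. F j \<in> lp_space h 1) \<Longrightarrow> lp_converges h p F f \<Longrightarrow>
       lp_converges h p (\<lambda>j. Op_l1 h \<sigma> (F j)) g"
  shows "Op h p \<sigma> f = g"
  unfolding Op_def
proof (rule the_equality)
  show "\<forall>F. (\<forall>j. F j \<in> lp_space h 1) \<and> lp_converges h p F f \<longrightarrow>
      lp_converges h p (\<lambda>j. Op_l1 h \<sigma> (F j)) g"
    using lim by blast
  fix g'
  assume g': "\<forall>F. (\<forall>j. F j \<in> lp_space h 1) \<and> lp_converges h p F f \<longrightarrow>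
      lp_converges h p (\<lambda>j. Op_l1 h \<sigma> (F j)) g'"
  obtain F where F: "\<And>j. F j \<in> lp_space h 1" "lp_converges h p F f"
    using lp_space_1_dense[OF f p] by metis
  show "g' = g"
    using lp_converges_unique[OF _ lim[OF F] p] g' F by blast
qed

theorem proposition6p15:
  fixes h p C :: real
    and \<sigma> :: "real ^ 'n \<Rightarrow> real ^ 'n \<Rightarrow> complex"
    and lam :: "real ^ 'n \<Rightarrow> complex"
  assumes "0 < h" "h \<le> 1"
    and "1 \<le> p"
    and "\<And>k. k \<in> hbar_lattice h \<Longrightarrow> periodic (\<sigma> k)"
    and "(\<lambda>(k, \<theta>). \<sigma> k \<theta>) \<in> borel_measurable (count_space (hbar_lattice h) \<Otimes>\<^sub>M torus)"
    and "\<And>k. k \<in> hbar_lattice h \<Longrightarrow> integrable torus (\<sigma> k)"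
    and "0 < C"
    and "lam \<in> lp_space h 1"
    and "\<And>k m. k \<in> hbar_lattice h \<Longrightarrow> m \<in> hbar_lattice h \<Longrightarrow> norm (symbol_fourier h \<sigma> k m) \<le> C * norm (lam m)"
  shows "lp_bounded_linear h p (Op h p \<sigma>)
       \<and> (\<forall>f \<in> lp_space h 1. Op h p \<sigma> f = Op_l1 h \<sigma> f)
       \<and> lp_onorm h p (Op h p \<sigma>) \<le> C * lp_norm h 1 lam"
proof -
  note p = \<open>1 \<le> p\<close> and \<sigma> = assms(6) and bound = assms(9)
  let ?T = "kernel_op h \<sigma>" and ?A = "C * lp_norm h 1 lam"
  \<comment> \<open>The strict inequality below keeps \<open>A\<close> positive even if \<open>lam = 0\<close>.\<close>
  define a where "a m = C * norm (lam m)" for m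
  have a: "a summable_on hbar_lattice h" "infsum a (hbar_lattice h) \<le> A" if "A > ?A" for A
    using lp_space_summable[OF \<open>lam \<in> lp_space h 1\<close>] that
    by (simp_all add: a_def[abs_def] lp_norm_def infsum_cmult_right' infsum_nonneg summable_on_cmult_right)
  have A0: "?A \<ge> 0" using \<open>0 < C\<close> by (simp add: lp_norm_nonneg)
  \<comment> \<open>The exponent \<open>q\<close> stays free: summability is needed at p and, to
    identify \<open>Op_l1\<close> with the matrix, at 1.\<close>
  have summable: "(\<lambda>m. symbol_fourier h \<sigma> k (m - k) * f m) summable_on hbar_lattice h"
    and mem: "?T f \<in> lp_space h q"
    and norm_le: "A > ?A \<Longrightarrow> lp_norm h q (?T f) \<le> A * lp_norm h q f"
    if "f \<in> lp_space h q" "1 \<le> q" "k \<in> hbar_lattice h" for f q k A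
  proof -
    note T = kernel_op_bounded[OF that(2) _ a bound[folded a_def] that(1)]
    \<comment> \<open>The first two facts do not mention \<open>A\<close>, so any admissible
      constant serves for them.\<close>
    have A: "?A + 1 > 0" "?A + 1 > ?A" using A0 by auto
    show "(\<lambda>m. symbol_fourier h \<sigma> k (m - k) * f m) summable_on hbar_lattice h"
      using T(1)[OF A(1) A(2) A(2)] that(3) by simp
    show "?T f \<in> lp_space h q"
      using T(2)[OF A(1) A(2) A(2)] by simp
    show "lp_norm h q (?T f) \<le> A * lp_norm h q f" if "A > ?A"
      using T(3)[OF _ that that] A0 that by simp
  qed
  \<comment> \<open>The point \<open>k\<close> occurs only in the summability claim; the origin
    discharges this premise in the other two.\<close>
  note mem = mem[OF _ _ zero_in_hbar_lattice] and norm_le = norm_le[OF _ _ zero_in_hbar_lattice]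
  have add: "?T (\<lambda>k. f k + g k) = (\<lambda>k. ?T f k + ?T g k)"
    if "f \<in> lp_space h p" "g \<in> lp_space h p" for f g
    using summable[OF that(1) p] summable[OF that(2) p]
    by (auto simp: kernel_op_def distrib_left fun_eq_iff infsum_add)
  \<comment> \<open>Scalars pass through \<open>infsum\<close> even for divergent series, where both
    sides are 0, so \<open>f\<close> is arbitrary.\<close>
  have cmult: "?T (\<lambda>k. c * f k) = (\<lambda>k. c * ?T f k)" for c f
    by (auto simp: kernel_op_def fun_eq_iff mult.left_commute infsum_cmult_right')
  have diff: "?T (\<lambda>k. f k - g k) = (\<lambda>k. ?T f k - ?T g k)"
    if "f \<in> lp_space h p" "g \<in> lp_space h p" for f g
    using add[OF that(1) lp_space_cmult[OF that(2), of "-1"]] cmult[of "-1" g] by simp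
  have Op_l1: "Op_l1 h \<sigma> f = ?T f" if "f \<in> lp_space h 1" for f
    using that by (intro Op_l1_eq_kernel_op \<sigma> summable[of _ 1]) auto
  have Op: "Op h p \<sigma> f = ?T f" if f: "f \<in> lp_space h p" for f
  proof (rule Op_eqI[OF p f])
    fix F :: "nat \<Rightarrow> real ^ 'n \<Rightarrow> complex"
    assume F: "\<And>j. F j \<in> lp_space h 1" "lp_converges h p F f"
    then have Fp: "F j \<in> lp_space h p" for j by (simp add: lp_converges_def)
    \<comment> \<open>By linearity the difference is the image of \<open>F j - f\<close>, to which
      the norm bound applies.\<close>
    have "(\<lambda>j. lp_norm h p (\<lambda>k. ?T (F j) k - ?T f k)) \<longlonglongrightarrow> 0"
    proof (rule Lim_null_comparison)
      show "\<forall>\<^sub>F j in sequentially. norm (lp_norm h p (\<lambda>k. ?T (F j) k - ?T f k))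
          \<le> (?A + 1) * lp_norm h p (\<lambda>k. F j k - f k)"
        using norm_le[OF lp_space_diff[OF Fp f p] p, of "?A + 1"]
        by (intro always_eventually) (simp add: lp_norm_nonneg diff Fp f)
      show "(\<lambda>j. (?A + 1) * lp_norm h p (\<lambda>k. F j k - f k)) \<longlonglongrightarrow> 0"
        using F(2) by (intro tendsto_mult_right_zero) (simp add: lp_converges_def)
    qed
    then show "lp_converges h p (\<lambda>j. Op_l1 h \<sigma> (F j)) (?T f)"
      using mem[OF _ p] by (simp add: lp_converges_def Op_l1 F Fp f)
  qed
  have "lp_bounded_linear h p (Op h p \<sigma>)"
    unfolding lp_bounded_linear_def
    using mem[OF _ p] norm_le[OF _ p, of _ "?A + 1"] p
    by (auto simp: Op add cmult lp_space_add lp_space_cmult)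
  moreover have "Op h p \<sigma> f = Op_l1 h \<sigma> f" if "f \<in> lp_space h 1" for f
    using that p by (simp add: Op Op_l1 lp_space_1_subset)
  moreover have "lp_onorm h p (Op h p \<sigma>) \<le> ?A"
  \<comment> \<open>The norm estimate is available for every constant strictly above
    \<open>?A\<close>; letting these decrease to \<open>?A\<close> gives the sharp bound.\<close>
  proof (rule dense_ge)
    fix A assume A: "?A < A"
    then have "A > 0" using A0 by simp
    \<comment> \<open>If the denominator is 0, the quotient is 0 by the convention for division, and
      positivity of \<open>A\<close> suffices.\<close>
    have "lp_norm h p (Op h p \<sigma> f) / lp_norm h p f \<le> A" if f: "f \<in> lp_space h p" for f
    proof (cases "lp_norm h p f = 0")
      case False
      then have "lp_norm h p f > 0" using lp_norm_nonneg[of h p f] by simp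
      then show ?thesis
        using norm_le[OF f p A] by (simp add: Op f field_simps)
    qed (use \<open>A > 0\<close> in simp)
    then show "lp_onorm h p (Op h p \<sigma>) \<le> A"
      unfolding lp_onorm_def using zero_in_lp_space by (intro cSUP_least) blast+
  qed
  ultimately show ?thesis by blast
qed

end
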